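(* Let $M,L$ be positive integers, $N=M+L-1$, let $y_0,\dots,y_{N-1}\in\mathbb{C}$ and $x_0,\dots,x_{N-1}\in\mathbb{C}$, and let $\omega\in[0,2\pi)$. Consider the constrained optimization problem in the unknowns $\mathbf{h}\in\mathbb{C}^M$ and $\alpha\in\mathbb{C}$: $$\min_{\mathbf{h},\alpha}\ \sum_{t=0}^{L-1}\left|\mathbf{h}^*\mathbf{y}(t)-\alpha\,x_t e^{i\omega t}\right|^2\qquad\text{subject to}\qquad \mathbf{h}^*(\mathbf{x}_M\circ\mathbf{a}_M(\omega))=1 .$$ Set $\|\mathbf{x}_L\|^2=\sum_{t=0}^{L-1}|x_t|^2$, $$\mathbf{g}(\omega)=\frac{1}{\|\mathbf{x}_L\|^2}\sum_{t=0}^{L-1}x_t^*e^{-i\omega t}\,\mathbf{y}(t)=\frac{1}{\|\mathbf{x}_L\|^2}\,\mathbf{Y}\,(\mathbf{x}_L\circ\mathbf{a}_L(\omega))^C,$$ $$\mathbf{Q}(\omega)=\frac{1}{\|\mathbf{x}_L\|^2}\left(\sum_{t=0}^{L-1}\mathbf{y}(t)\,\mathbf{y}(t)^*\right)-\mathbf{g}(\omega)\,\mathbf{g}(\omega)^*=\frac{1}{\|\mathbf{x}_L\|^2}\,\mathbf{Y}\mathbf{Y}^*-\mathbf{g}(\omega)\,\mathbf{g}(\omega)^* .$$ Assume that the expressions below are well defined, i.e. $\mathbf{x}_L\neq 0$, $\mathbf{Q}(\omega)$ is invertible, and the denominator below is nonzero. Then the problem has as solution $(\mathbf{h},\alpha)=(\mathbf{h}_{NAPES}(\omega),\alpha_{NAPES}(\omega))$,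 where $$\mathbf{h}_{NAPES}(\omega)=\frac{\mathbf{Q}(\omega)^{-1}(\mathbf{x}_M\circ\mathbf{a}_M(\omega))}{(\mathbf{x}_M\circ\mathbf{a}_M(\omega))^*\,\mathbf{Q}(\omega)^{-1}(\mathbf{x}_M\circ\mathbf{a}_M(\omega))},\qquad \alpha_{NAPES}(\omega)=\mathbf{h}_{NAPES}(\omega)^*\,\mathbf{g}(\omega).$$
   Context: For a complex number $z$, $z^*$ is its complex conjugate and $|z|$ its modulus. For a complex matrix or vector $A$, $A^T$, $A^*$ and $A^C$ denote respectively the transpose, the conjugate transpose and the entrywise complex conjugate. $\circ$ is the Hadamard (entrywise) product. $\|\cdot\|$ is the Euclidean norm. Here $(y_n)$ is the data sequence and $(x_n)$ the known noise sequence; $i^2=-1$. For $t=0,\dots,L-1$, $\mathbf{y}(t)=(y_t,y_{t+1},\dots,y_{t+M-1})^T\in\mathbb{C}^M$, and $\mathbf{Y}$ is the $M\times L$ complex matrix whose columns are $\mathbf{y}(0),\dots,\mathbf{y}(L-1)$. For an integer $K>0$, $\mathbf{a}_K(\omega)=(1,e^{i\omega},\dots,e^{i(K-1)\omega})^T\in\mathbb{C}^K$, and for $0<K\le N$, $\mathbf{x}_K=(x_0,x_1,\dots,x_{K-1})^T\in\mathbb{C}^K$. *)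

theory Defs
  imports Complex_Main
    "Jordan_Normal_Form.Schur_Decomposition"
    "Jordan_Normal_Form.Gauss_Jordan_Elimination"
begin

text \<open>
  Sizes are natural numbers, vectors and matrices are those of \<^theory>\<open>Jordan_Normal_Form.Matrix\<close>.
  For complex vectors \<^term>\<open>conjugate v \<bullet> w\<close> is the product $v^* w$, and
  \<^term>\<open>vec_first x K\<close> is $x_K$, the vector of the first $K$ entries of $x$.
\<close>

definition hadamard_vec :: "complex vec \<Rightarrow> complex vec \<Rightarrow> complex vec" (infixl \<open>\<circ>\<^sub>v\<close> 75) where
  "v \<circ>\<^sub>v w = vec (dim_vec v) (\<lambda>i. v $ i * w $ i)"

definition sq_norm_cvec :: "complex vec \<Rightarrow> real" where
  "sq_norm_cvec v = (\<Sum>i<dim_vec v. (cmod (v $ i))\<^sup>2)"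

text \<open>\<open>outer_prod v w\<close> is the matrix $v w^*$.\<close>

definition outer_prod :: "complex vec \<Rightarrow> complex vec \<Rightarrow> complex mat" where
  "outer_prod v w = mat (dim_vec v) (dim_vec w) (\<lambda>(i, j). v $ i * cnj (w $ j))"

text \<open>The matrix analogue of \<^const>\<open>finsum_vec\<close>.\<close>

definition finsum_mat :: "nat \<Rightarrow> nat \<Rightarrow> ('c \<Rightarrow> complex mat) \<Rightarrow> 'c set \<Rightarrow> complex mat" where
  "finsum_mat nr nc = finprod (monoid_mat TYPE(complex) nr nc)"

text \<open>The value is meaningful only for invertible \<open>A\<close>.\<close>

definition inv_mat :: "complex mat \<Rightarrow> complex mat" where
  "inv_mat A = the (mat_inverse A)"

definition steering :: "nat \<Rightarrow> real \<Rightarrow> complex vec" where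
  "steering K \<omega> = vec K (\<lambda>k. exp (\<i> * of_real (real k * \<omega>)))"

definition modulated_noise :: "nat \<Rightarrow> complex vec \<Rightarrow> real \<Rightarrow> complex vec" where
  "modulated_noise K x \<omega> = vec_first x K \<circ>\<^sub>v steering K \<omega>"

definition snapshot :: "nat \<Rightarrow> complex vec \<Rightarrow> nat \<Rightarrow> complex vec" where
  "snapshot M y t = vec M (\<lambda>j. y $ (t + j))"

definition data_mat :: "nat \<Rightarrow> nat \<Rightarrow> complex vec \<Rightarrow> complex mat" where
  "data_mat M L y = mat_of_cols M (map (snapshot M y) [0..<L])"

definition napes_objective ::
  "nat \<Rightarrow> nat \<Rightarrow> complex vec \<Rightarrow> complex vec \<Rightarrow> real \<Rightarrow> complex vec \<times> complex \<Rightarrow> real" where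
  "napes_objective M L y x \<omega> = (\<lambda>(h, \<alpha>).
     \<Sum>t<L. (cmod (conjugate h \<bullet> snapshot M y t - \<alpha> * x $ t * exp (\<i> * of_real (\<omega> * real t))))\<^sup>2)"

definition napes_feasible ::
  "nat \<Rightarrow> complex vec \<Rightarrow> real \<Rightarrow> complex vec \<times> complex \<Rightarrow> bool" where
  "napes_feasible M x \<omega> = (\<lambda>(h, \<alpha>).
     h \<in> carrier_vec M \<and> conjugate h \<bullet> modulated_noise M x \<omega> = 1)"

definition napes_g :: "nat \<Rightarrow> nat \<Rightarrow> complex vec \<Rightarrow> complex vec \<Rightarrow> real \<Rightarrow> complex vec" where
  "napes_g M L y x \<omega> =
     of_real (1 / sq_norm_cvec (vec_first x L)) \<cdot>\<^sub>v
     finsum_vec TYPE(complex) M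
       (\<lambda>t. (cnj (x $ t) * exp (- \<i> * of_real (\<omega> * real t))) \<cdot>\<^sub>v snapshot M y t) {..<L}"

definition napes_Q :: "nat \<Rightarrow> nat \<Rightarrow> complex vec \<Rightarrow> complex vec \<Rightarrow> real \<Rightarrow> complex mat" where
  "napes_Q M L y x \<omega> =
     of_real (1 / sq_norm_cvec (vec_first x L)) \<cdot>\<^sub>m
     finsum_mat M M (\<lambda>t. outer_prod (snapshot M y t) (snapshot M y t)) {..<L}
     - outer_prod (napes_g M L y x \<omega>) (napes_g M L y x \<omega>)"

definition napes_denom :: "nat \<Rightarrow> nat \<Rightarrow> complex vec \<Rightarrow> complex vec \<Rightarrow> real \<Rightarrow> complex" where
  "napes_denom M L y x \<omega> =
     conjugate (modulated_noise M x \<omega>) \<bullet>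
       (inv_mat (napes_Q M L y x \<omega>) *\<^sub>v modulated_noise M x \<omega>)"

definition napes_h :: "nat \<Rightarrow> nat \<Rightarrow> complex vec \<Rightarrow> complex vec \<Rightarrow> real \<Rightarrow> complex vec" where
  "napes_h M L y x \<omega> =
     (1 / napes_denom M L y x \<omega>) \<cdot>\<^sub>v
     (inv_mat (napes_Q M L y x \<omega>) *\<^sub>v modulated_noise M x \<omega>)"

definition napes_alpha :: "nat \<Rightarrow> nat \<Rightarrow> complex vec \<Rightarrow> complex vec \<Rightarrow> real \<Rightarrow> complex" where
  "napes_alpha M L y x \<omega> = conjugate (napes_h M L y x \<omega>) \<bullet> napes_g M L y x \<omega>"

end

theory Submission
  imports Defs
begin

text \<open>
  The constraint is linear, so a feasible point whose residual
  $r_t = h^* y(t) - \alpha x_t e^{i \omega t}$ is orthogonal to every difference of feasible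
  residuals is a minimiser. The choice $\alpha = h^* g$ makes the residual orthogonal to the
  sequence $x_t e^{i \omega t}$, and then for a direction $u$ in $h$ the remaining inner product is
  $\|x_L\|^2 \, u^* Q h$. For $h$ a multiple of $Q^{-1} b$, where $b$ is the modulated noise, this is a
  multiple of $u^* b$, which vanishes for a difference $u$ of feasible vectors.
\<close>

text \<open>Pythagoras: expanding \<open>r = r0 + (r - r0)\<close> leaves the squared distance of
  \<open>r\<close> from \<open>r0\<close>, which is nonnegative, and a cross term that the
  assumption kills.\<close>

lemma sum_cmod_sq_le_if_orthogonal:
  fixes r r0 :: "'a \<Rightarrow> complex"
  assumes "(\<Sum>t\<in>A. (r t - r0 t) * cnj (r0 t)) = 0"
  shows "(\<Sum>t\<in>A. (cmod (r0 t))\<^sup>2) \<le> (\<Sum>t\<in>A. (cmod (r t))\<^sup>2)"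
proof -
  have "(cmod z)\<^sup>2 = (cmod w)\<^sup>2 + (cmod (z - w))\<^sup>2 + 2 * Re ((z - w) * cnj w)" for z w
    unfolding cmod_power2 by (simp add: power2_eq_square algebra_simps)
  then have "(\<Sum>t\<in>A. (cmod (r t))\<^sup>2) = (\<Sum>t\<in>A. (cmod (r0 t))\<^sup>2) + (\<Sum>t\<in>A. (cmod (r t - r0 t))\<^sup>2)
      + 2 * Re (\<Sum>t\<in>A. (r t - r0 t) * cnj (r0 t))"
    unfolding Re_sum sum_distrib_left sum.distrib[symmetric] by (intro sum.cong refl)
  with assms show ?thesis
    by (simp add: sum_nonneg)
qed

section \<open>Complex scalar products and finite sums of vectors and matrices\<close>

lemma conjugate_minus_scalar_prod:
  fixes u v w :: "complex vec"
  assumes "u \<in> carrier_vec n" "v \<in> carrier_vec n" "w \<in> carrier_vec n"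
  shows "conjugate (u - v) \<bullet> w = conjugate u \<bullet> w - conjugate v \<bullet> w"
  using assms by (simp add: scalar_prod_def algebra_simps sum_subtractf)

lemma cnj_scalar_prod:
  fixes u v :: "complex vec"
  assumes "u \<in> carrier_vec n" "v \<in> carrier_vec n"
  shows "cnj (conjugate u \<bullet> v) = conjugate v \<bullet> u"
  using assms by (simp add: scalar_prod_def mult.commute)

lemma scalar_prod_finsum_vec:
  fixes u :: "complex vec"
  assumes "finite A" "u \<in> carrier_vec n" "f \<in> A \<rightarrow> carrier_vec n"
  shows "u \<bullet> finsum_vec TYPE(complex) n f A = (\<Sum>t\<in>A. u \<bullet> f t)"
  using assms
proof (induction A rule: finite_induct)
  case (insert a A)
  then have f: "f \<in> A \<rightarrow> carrier_vec n" "f a \<in> carrier_vec n"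
    by auto
  with insert show ?case
    by (simp add: finsum_vec_insert finsum_vec_closed scalar_prod_add_distrib[of _ n])
qed (simp add: finsum_vec_empty)

lemma monoid_mat_simps:
  "monoid.mult (monoid_mat TYPE(complex) nr nc) = (+)"
  "carrier (monoid_mat TYPE(complex) nr nc) = carrier_mat nr nc"
  "one (monoid_mat TYPE(complex) nr nc) = 0\<^sub>m nr nc"
  unfolding monoid_mat_def by auto

text \<open>The operation of \<open>monoid_mat\<close> is matrix addition, so the rules for
  \<open>finprod\<close> become rules for \<open>finsum_mat\<close> once the monoid operations are
  unfolded.\<close>

lemmas finsum_mat_insert =
  comm_monoid.finprod_insert[OF comm_monoid_mat[where 'a = complex], folded finsum_mat_def, unfolded monoid_mat_simps]

lemmas finsum_mat_closed =
  comm_monoid.finprod_closed[OF comm_monoid_mat[where 'a = complex], folded finsum_mat_def, unfolded monoid_mat_simps]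

lemmas finsum_mat_empty =
  comm_monoid.finprod_empty[OF comm_monoid_mat[where 'a = complex], folded finsum_mat_def, unfolded monoid_mat_simps]

lemma index_finsum_mat:
  assumes "finite A" "f \<in> A \<rightarrow> carrier_mat nr nc" "i < nr" "j < nc"
  shows "finsum_mat nr nc f A $$ (i, j) = (\<Sum>t\<in>A. f t $$ (i, j))"
  using assms
proof (induction A rule: finite_induct)
  case (insert a A)
  then have f: "f \<in> A \<rightarrow> carrier_mat nr nc" "f a \<in> carrier_mat nr nc"
    by auto
  have "finsum_mat nr nc f A \<in> carrier_mat nr nc"
    using f(1) by (rule finsum_mat_closed)
  with insert f show ?case
    by (simp add: finsum_mat_insert)
qed (simp add: finsum_mat_empty)

lemma scalar_prod_finsum_mat_mult_vec:
  fixes u v :: "complex vec"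
  assumes "finite A" "u \<in> carrier_vec nr" "v \<in> carrier_vec nc" "f \<in> A \<rightarrow> carrier_mat nr nc"
  shows "u \<bullet> (finsum_mat nr nc f A *\<^sub>v v) = (\<Sum>t\<in>A. u \<bullet> (f t *\<^sub>v v))"
  using assms
proof (induction A rule: finite_induct)
  case empty
  have "0\<^sub>m nr nc *\<^sub>v v = 0\<^sub>v nr"
    using empty by (intro eq_vecI) auto
  with empty show ?case
    by (simp add: finsum_mat_empty)
next
  case (insert a A)
  then have f: "f \<in> A \<rightarrow> carrier_mat nr nc" "f a \<in> carrier_mat nr nc"
    by auto
  have "finsum_mat nr nc f A \<in> carrier_mat nr nc"
    using f(1) by (rule finsum_mat_closed)
  with insert f show ?case
    by (simp add: finsum_mat_insert add_mult_distrib_mat_vec[of _ nr nc]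
        scalar_prod_add_distrib[of _ nr] mult_mat_vec_carrier[of _ nr nc])
qed

section \<open>Rank-one matrices and the inverse\<close>

lemma outer_prod_carrier:
  "v \<in> carrier_vec n \<Longrightarrow> w \<in> carrier_vec m \<Longrightarrow> outer_prod v w \<in> carrier_mat n m"
  by (auto simp: outer_prod_def)

lemma scalar_prod_outer_prod_mult_vec:
  assumes "u \<in> carrier_vec n" "v \<in> carrier_vec n" "w \<in> carrier_vec m" "z \<in> carrier_vec m"
  shows "u \<bullet> (outer_prod v w *\<^sub>v z) = (u \<bullet> v) * (conjugate w \<bullet> z)"
proof -
  have "outer_prod v w *\<^sub>v z = (conjugate w \<bullet> z) \<cdot>\<^sub>v v"
    using assms
    by (intro eq_vecI) (auto simp: outer_prod_def scalar_prod_def sum_distrib_left sum_distrib_right ac_simps)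
  then show ?thesis
    using assms by simp
qed

lemma minus_mult_distrib_mat_vec:
  fixes A B :: "complex mat"
  assumes "A \<in> carrier_mat nr nc" "B \<in> carrier_mat nr nc" "v \<in> carrier_vec nc"
  shows "(A - B) *\<^sub>v v = A *\<^sub>v v - B *\<^sub>v v"
  using assms by (intro eq_vecI) (auto simp: scalar_prod_def algebra_simps sum_subtractf)

lemma smult_mat_mult_vec:
  fixes A :: "complex mat"
  assumes "A \<in> carrier_mat nr nc" "v \<in> carrier_vec nc"
  shows "(k \<cdot>\<^sub>m A) *\<^sub>v v = k \<cdot>\<^sub>v (A *\<^sub>v v)"
  using assms by (intro eq_vecI) (auto simp: scalar_prod_def sum_distrib_left ac_simps)

text \<open>Connects the abstract notion \<open>invertible_mat\<close> with the computed inverse: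
  \<open>the\<close> in \<open>inv_mat\<close> is harmless because Gauss-Jordan elimination succeeds
  on every unit of the matrix ring.\<close>

lemma mult_inv_mat:
  assumes "A \<in> carrier_mat n n" "invertible_mat A"
  shows "inv_mat A \<in> carrier_mat n n" "A * inv_mat A = 1\<^sub>m n"
proof -
  obtain B where B: "A * B = 1\<^sub>m n" "B * A = 1\<^sub>m (dim_row B)"
    using assms by (auto simp: invertible_mat_def inverts_mat_def)
  \<comment> \<open>\<open>invertible_mat\<close> does not fix the shape of \<open>B\<close>;
    comparing column counts in the two equations does.\<close>
  have "dim_col B = n" "dim_row B = n"
    using B[THEN arg_cong[of _ _ dim_col]] assms(1) by simp_all
  then have "B \<in> carrier_mat n n"
    by (intro carrier_matI)
  with B assms(1) have "A \<in> Units (ring_mat TYPE(complex) n ())"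
    by (auto simp: Units_def ring_mat_def)
  \<comment> \<open>The result \<open>None\<close> would mean that \<open>A\<close> is not a
    unit.\<close>
  then obtain C where "mat_inverse A = Some C"
    using mat_inverse(1)[OF assms(1), where b = "()"] by (cases "mat_inverse A") auto
  with mat_inverse(2)[OF assms(1)] show "inv_mat A \<in> carrier_mat n n" "A * inv_mat A = 1\<^sub>m n"
    by (auto simp: inv_mat_def)
qed

section \<open>Noise, snapshots and the forms given by g and Q\<close>

lemma snapshot_carrier: "snapshot M y t \<in> carrier_vec M"
  by (simp add: snapshot_def)

lemma modulated_noise_carrier: "modulated_noise K x \<omega> \<in> carrier_vec K"
  by (simp add: modulated_noise_def hadamard_vec_def steering_def vec_first_def)

lemma modulated_noise_index:
  "t < K \<Longrightarrow> modulated_noise K x \<omega> $ t = x $ t * exp (\<i> * of_real (\<omega> * real t))"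
  by (simp add: modulated_noise_def hadamard_vec_def steering_def vec_first_def mult.commute)

lemma cnj_modulated_noise_index:
  assumes "t < K"
  shows "cnj (modulated_noise K x \<omega> $ t) = cnj (x $ t) * exp (- \<i> * of_real (\<omega> * real t))"
  using assms cis_cnj[of "\<omega> * real t"] by (simp add: modulated_noise_index cis_conv_exp)

text \<open>For fixed h this is a least-squares fit of the filter output by a multiple of one fixed
  vector, the modulated noise.\<close>

lemma napes_objective_eq:
  "napes_objective M L y x \<omega> (h, \<alpha>) =
    (\<Sum>t<L. (cmod (conjugate h \<bullet> snapshot M y t - \<alpha> * modulated_noise L x \<omega> $ t))\<^sup>2)"
  by (simp add: napes_objective_def modulated_noise_index mult.assoc)

lemma napes_g_eq:
  "napes_g M L y x \<omega> = of_real (1 / sq_norm_cvec (vec_first x L)) \<cdot>\<^sub>v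
     finsum_vec TYPE(complex) M
       (\<lambda>t. cnj (modulated_noise L x \<omega> $ t) \<cdot>\<^sub>v snapshot M y t) {..<L}"
proof -
  \<comment> \<open>The summands are compared only for t < L, the range in which the entries of the
    modulated noise are known.\<close>
  have "finsum_vec TYPE(complex) M
       (\<lambda>t. (cnj (x $ t) * exp (- \<i> * of_real (\<omega> * real t))) \<cdot>\<^sub>v snapshot M y t) {..<L} =
     finsum_vec TYPE(complex) M
       (\<lambda>t. cnj (modulated_noise L x \<omega> $ t) \<cdot>\<^sub>v snapshot M y t) {..<L}"
    unfolding finsum_vec_def
    by (rule comm_monoid.finprod_cong'[OF comm_monoid_vec])
      (auto simp: cnj_modulated_noise_index snapshot_carrier monoid_vec_simps)
  then show ?thesis
    by (simp add: napes_g_def)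
qed

lemma finsum_snapshot_carrier:
  "finsum_vec TYPE(complex) M (\<lambda>t. c t \<cdot>\<^sub>v snapshot M y t) A \<in> carrier_vec M"
  by (rule finsum_vec_closed) (simp add: snapshot_carrier)

lemma napes_g_carrier: "napes_g M L y x \<omega> \<in> carrier_vec M"
  by (simp add: napes_g_eq finsum_snapshot_carrier)

lemma finsum_outer_snapshot_carrier:
  "finsum_mat M M (\<lambda>t. outer_prod (snapshot M y t) (snapshot M y t)) A \<in> carrier_mat M M"
  by (rule finsum_mat_closed) (simp add: outer_prod_carrier snapshot_carrier)

lemma napes_Q_carrier: "napes_Q M L y x \<omega> \<in> carrier_mat M M"
  using outer_prod_carrier[OF napes_g_carrier napes_g_carrier]
  by (simp add: napes_Q_def minus_carrier_mat)

lemma scalar_prod_napes_g: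
  assumes "u \<in> carrier_vec M"
  shows "u \<bullet> napes_g M L y x \<omega> = of_real (1 / sq_norm_cvec (vec_first x L)) *
    (\<Sum>t<L. cnj (modulated_noise L x \<omega> $ t) * (u \<bullet> snapshot M y t))"
  using assms
  by (simp add: napes_g_eq scalar_prod_smult_distrib[of _ M] finsum_snapshot_carrier
      scalar_prod_finsum_vec snapshot_carrier)

text \<open>Each rank-one term contributes (u . y) (y^* v), and y^* v is the conjugate of v^* y. So
  \<open>v\<close> enters through its filter outputs, while \<open>u\<close> is an unconjugated
  linear form, later the conjugate of a direction in h.\<close>

lemma scalar_prod_napes_Q:
  assumes u: "u \<in> carrier_vec M" and v: "v \<in> carrier_vec M"
  shows "u \<bullet> (napes_Q M L y x \<omega> *\<^sub>v v) = of_real (1 / sq_norm_cvec (vec_first x L)) *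
    (\<Sum>t<L. (u \<bullet> snapshot M y t) * cnj (conjugate v \<bullet> snapshot M y t))
    - (u \<bullet> napes_g M L y x \<omega>) * cnj (conjugate v \<bullet> napes_g M L y x \<omega>)"
proof -
  let ?S = "finsum_mat M M (\<lambda>t. outer_prod (snapshot M y t) (snapshot M y t)) {..<L}"
  let ?G = "outer_prod (napes_g M L y x \<omega>) (napes_g M L y x \<omega>)"
  have S: "?S \<in> carrier_mat M M"
    by (rule finsum_outer_snapshot_carrier)
  have G: "?G \<in> carrier_mat M M"
    by (intro outer_prod_carrier napes_g_carrier)
  have "u \<bullet> (?S *\<^sub>v v) =
      (\<Sum>t<L. (u \<bullet> snapshot M y t) * cnj (conjugate v \<bullet> snapshot M y t))"
    using u v
    by (simp add: scalar_prod_finsum_mat_mult_vec scalar_prod_outer_prod_mult_vec[of _ M _ _ M]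
        outer_prod_carrier snapshot_carrier cnj_scalar_prod[of _ M])
  moreover have "u \<bullet> (?G *\<^sub>v v) = (u \<bullet> napes_g M L y x \<omega>) * cnj (conjugate v \<bullet> napes_g M L y x \<omega>)"
    using u v
    by (simp add: scalar_prod_outer_prod_mult_vec[of _ M _ _ M] napes_g_carrier cnj_scalar_prod[of _ M])
  moreover have "napes_Q M L y x \<omega> *\<^sub>v v =
      of_real (1 / sq_norm_cvec (vec_first x L)) \<cdot>\<^sub>v (?S *\<^sub>v v) - ?G *\<^sub>v v"
    using S G v unfolding napes_Q_def
    by (simp add: minus_mult_distrib_mat_vec[of _ M M] smult_mat_mult_vec[of _ M M])
  moreover have "?S *\<^sub>v v \<in> carrier_vec M" "?G *\<^sub>v v \<in> carrier_vec M"
    using S G v by (auto intro: mult_mat_vec_carrier)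
  ultimately show ?thesis
    using u by (simp add: scalar_prod_minus_distrib[of _ M] scalar_prod_smult_distrib[of _ M])
qed

lemma sq_norm_cvec_pos:
  assumes "v \<in> carrier_vec n" "v \<noteq> 0\<^sub>v n"
  shows "0 < sq_norm_cvec v"
proof -
  obtain i where "i < n" "v $ i \<noteq> 0"
    using assms by (auto simp: vec_eq_iff)
  with assms(1) show ?thesis
    unfolding sq_norm_cvec_def by (intro sum_pos2[of _ i]) auto
qed

text \<open>The modulation factors have modulus 1, so they leave the norm of the noise
  unchanged.\<close>

lemma sum_modulated_noise:
  "(\<Sum>t<L. modulated_noise L x \<omega> $ t * cnj (modulated_noise L x \<omega> $ t)) =
    of_real (sq_norm_cvec (vec_first x L))"
proof -
  have "(cmod (modulated_noise L x \<omega> $ t))\<^sup>2 = (cmod (vec_first x L $ t))\<^sup>2" if "t < L" for t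
    using that by (simp add: modulated_noise_index norm_mult vec_first_def)
  then show ?thesis
    by (simp add: sq_norm_cvec_def vec_first_def flip: complex_norm_square)
qed

section \<open>Expressions through the data matrix\<close>

lemma napes_g_eq_data_mat:
  "napes_g M L y x \<omega> = of_real (1 / sq_norm_cvec (vec_first x L)) \<cdot>\<^sub>v
     (data_mat M L y *\<^sub>v conjugate (modulated_noise L x \<omega>))"
proof -
  have "finsum_vec TYPE(complex) M
      (\<lambda>t. cnj (modulated_noise L x \<omega> $ t) \<cdot>\<^sub>v snapshot M y t) {..<L} =
      data_mat M L y *\<^sub>v conjugate (modulated_noise L x \<omega>)" (is "?l = ?r")
  proof (rule eq_vecI)
    show "dim_vec ?l = dim_vec ?r"
      using carrier_vecD[OF finsum_snapshot_carrier] by (simp add: data_mat_def)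
    fix i assume "i < dim_vec ?r"
    then have "i < M"
      by (simp add: data_mat_def)
    then show "?l $ i = ?r $ i"
      using carrier_vecD[OF modulated_noise_carrier[of L x \<omega>]]
      by (simp add: index_finsum_vec data_mat_def scalar_prod_def mat_of_cols_index
          snapshot_carrier snapshot_def atLeast0LessThan mult.commute)
  qed
  then show ?thesis
    by (simp add: napes_g_eq)
qed

text \<open>The columns of the data matrix are the snapshots, so entry (i, j) on either side is the
  sum over t < L of \<open>y $ (t + i)\<close> times the conjugate of
  \<open>y $ (t + j)\<close>.\<close>

lemma finsum_outer_snapshot_eq_data_mat:
  "finsum_mat M M (\<lambda>t. outer_prod (snapshot M y t) (snapshot M y t)) {..<L} =
    data_mat M L y * mat_adjoint (data_mat M L y)" (is "?l = ?r")
proof (rule eq_matI)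
  show "dim_row ?l = dim_row ?r" "dim_col ?l = dim_col ?r"
    using carrier_matD[OF finsum_outer_snapshot_carrier[of M y "{..<L}"]]
    by (simp_all add: data_mat_def mat_adjoint_def)
  fix i j assume "i < dim_row ?r" "j < dim_col ?r"
  then have "i < M" "j < M"
    by (simp_all add: data_mat_def mat_adjoint_def)
  then show "?l $$ (i, j) = ?r $$ (i, j)"
    by (simp add: index_finsum_mat outer_prod_carrier snapshot_carrier)
      (simp add: outer_prod_def data_mat_def mat_adjoint_def scalar_prod_def mat_of_cols_index
        mat_of_rows_index snapshot_def atLeast0LessThan)
qed

section \<open>Properties of the filter\<close>

lemma napes_h_carrier:
  assumes "invertible_mat (napes_Q M L y x \<omega>)"
  shows "napes_h M L y x \<omega> \<in> carrier_vec M"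
  using mult_inv_mat(1)[OF napes_Q_carrier assms] modulated_noise_carrier
  by (simp add: napes_h_def mult_mat_vec_carrier[of _ M M])

text \<open>This is the stationarity condition in h: Q h is parallel to the constraint vector, with
  the reciprocal of the denominator as multiplier.\<close>

lemma napes_Q_mult_napes_h:
  assumes "invertible_mat (napes_Q M L y x \<omega>)"
  shows "napes_Q M L y x \<omega> *\<^sub>v napes_h M L y x \<omega> =
    (1 / napes_denom M L y x \<omega>) \<cdot>\<^sub>v modulated_noise M x \<omega>"
proof -
  let ?Q = "napes_Q M L y x \<omega>" and ?b = "modulated_noise M x \<omega>"
  note inv = mult_inv_mat[OF napes_Q_carrier assms]
  have "?Q *\<^sub>v (inv_mat ?Q *\<^sub>v ?b) = ?b"
    using inv modulated_noise_carrier napes_Q_carrier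
    by (simp flip: assoc_mult_mat_vec[of _ M M _ M])
  with inv(1) show ?thesis
    unfolding napes_h_def
    by (subst mult_mat_vec[OF napes_Q_carrier])
      (auto intro: mult_mat_vec_carrier modulated_noise_carrier)
qed

text \<open>The normalisation gives b^* h = 1 directly, where b is the modulated noise; the
  constraint h^* b = 1 is the conjugate of this.\<close>

lemma napes_h_constraint:
  assumes "invertible_mat (napes_Q M L y x \<omega>)" "napes_denom M L y x \<omega> \<noteq> 0"
  shows "conjugate (napes_h M L y x \<omega>) \<bullet> modulated_noise M x \<omega> = 1"
proof -
  have "conjugate (modulated_noise M x \<omega>) \<bullet> napes_h M L y x \<omega> = 1"
    using assms(2) mult_inv_mat(1)[OF napes_Q_carrier assms(1)] modulated_noise_carrier[of M x \<omega>]
    by (simp add: napes_h_def napes_denom_def scalar_prod_smult_distrib[of _ M]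
        mult_mat_vec_carrier[of _ M M])
  then show ?thesis
    using cnj_scalar_prod[OF modulated_noise_carrier napes_h_carrier[OF assms(1)]]
    by (metis complex_cnj_one)
qed

section \<open>Optimality\<close>

lemma is_arg_min_napes:
  assumes "vec_first x L \<noteq> 0\<^sub>v L" "invertible_mat (napes_Q M L y x \<omega>)" "napes_denom M L y x \<omega> \<noteq> 0"
  shows "is_arg_min (napes_objective M L y x \<omega>) (napes_feasible M x \<omega>)
    (napes_h M L y x \<omega>, napes_alpha M L y x \<omega>)"
proof -
  define s c Y b g h0 \<alpha>0 where "s = complex_of_real (sq_norm_cvec (vec_first x L))"
    and "c = (\<lambda>t. modulated_noise L x \<omega> $ t)" and "Y = snapshot M y"
    and "b = modulated_noise M x \<omega>" and "g = napes_g M L y x \<omega>"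
    and "h0 = napes_h M L y x \<omega>" and "\<alpha>0 = napes_alpha M L y x \<omega>"
  have s: "s \<noteq> 0"
    using sq_norm_cvec_pos[OF vec_first_carrier assms(1)] by (simp add: s_def)
  have h0: "h0 \<in> carrier_vec M" and b: "b \<in> carrier_vec M"
    unfolding h0_def b_def by (simp_all add: napes_h_carrier assms modulated_noise_carrier)
  have h0b: "conjugate h0 \<bullet> b = 1"
    unfolding h0_def b_def by (rule napes_h_constraint) fact+
  have \<alpha>0: "\<alpha>0 = conjugate h0 \<bullet> g"
    by (simp add: \<alpha>0_def napes_alpha_def h0_def g_def)
  \<comment> \<open>Since \<open>s\<close> is nonzero, the normalising factor of g can be cleared;
    in this form g turns correlations with the noise into scalar products.\<close>
  have g: "(\<Sum>t<L. cnj (c t) * (u \<bullet> Y t)) = s * (u \<bullet> g)" if "u \<in> carrier_vec M" for u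
    using s that by (simp add: scalar_prod_napes_g g_def c_def Y_def s_def)
  have cc: "(\<Sum>t<L. c t * cnj (c t)) = s"
    unfolding c_def s_def by (rule sum_modulated_noise)
  \<comment> \<open>Normal equation for \<alpha>: by \<open>g\<close> and \<open>cc\<close>, h0^* g
    is the least-squares coefficient of the filter output along \<open>c\<close>. The two terms
    cancel because \<open>s\<close> is real.\<close>
  have noise_orth: "(\<Sum>t<L. c t * cnj (conjugate h0 \<bullet> Y t - \<alpha>0 * c t)) = 0"
  proof -
    have "(\<Sum>t<L. c t * cnj (conjugate h0 \<bullet> Y t - \<alpha>0 * c t)) =
        cnj (\<Sum>t<L. cnj (c t) * (conjugate h0 \<bullet> Y t)) - cnj \<alpha>0 * (\<Sum>t<L. c t * cnj (c t))"
      by (simp add: algebra_simps sum_subtractf sum_distrib_left)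
    also have "\<dots> = cnj (s * (conjugate h0 \<bullet> g)) - cnj \<alpha>0 * s"
      using h0 by (simp add: g cc)
    finally show ?thesis
      by (simp add: \<alpha>0 s_def)
  qed
  \<comment> \<open>Here \<open>u\<close> stands for the conjugate of an admissible direction in h,
    so the linearised constraint is \<open>u \<bullet> b = 0\<close> without a further
    conjugate.\<close>
  have snapshot_orth: "(\<Sum>t<L. (u \<bullet> Y t) * cnj (conjugate h0 \<bullet> Y t - \<alpha>0 * c t)) = 0"
    if u: "u \<in> carrier_vec M" and ub: "u \<bullet> b = 0" for u
  proof -
    have "u \<bullet> (napes_Q M L y x \<omega> *\<^sub>v h0) = 0"
      using u b ub unfolding h0_def
      by (simp add: napes_Q_mult_napes_h assms scalar_prod_smult_distrib[of _ M] flip: b_def)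
    \<comment> \<open>As the form of Q vanishes at \<open>u\<close> and \<open>h0\<close>, its two
      parts agree. By \<open>g\<close>, the right-hand side is also what the \<alpha>0 part of the
      residual contributes, so the two cancel.\<close>
    then have "(\<Sum>t<L. (u \<bullet> Y t) * cnj (conjugate h0 \<bullet> Y t)) = s * (u \<bullet> g) * cnj \<alpha>0"
      using u h0 s unfolding scalar_prod_napes_Q[OF u h0]
      by (simp add: \<alpha>0 g_def Y_def s_def field_simps)
    then show ?thesis
      using g[OF u]
      by (simp add: algebra_simps sum_subtractf flip: sum_distrib_left)
  qed
  have "napes_objective M L y x \<omega> (h0, \<alpha>0) \<le> napes_objective M L y x \<omega> (h, \<alpha>)"
    if h: "h \<in> carrier_vec M" and hb: "conjugate h \<bullet> b = 1" for h \<alpha>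
    unfolding napes_objective_eq c_def[THEN fun_cong, symmetric] Y_def[symmetric]
  proof (rule sum_cmod_sq_le_if_orthogonal)
    let ?u = "conjugate (h - h0)" and ?r = "\<lambda>t. cnj (conjugate h0 \<bullet> Y t - \<alpha>0 * c t)"
    have "?u \<bullet> b = 0"
      using h h0 b hb h0b by (simp add: conjugate_minus_scalar_prod[of _ M])
    then have "(\<Sum>t<L. (?u \<bullet> Y t) * ?r t) = 0"
      using h h0 by (intro snapshot_orth) auto
    moreover have "conjugate h \<bullet> Y t = ?u \<bullet> Y t + conjugate h0 \<bullet> Y t" for t
      using h h0 by (simp add: conjugate_minus_scalar_prod[of _ M] Y_def snapshot_carrier)
    \<comment> \<open>The difference of the residuals splits into a change of filter and a change of
      amplitude, one for each orthogonality relation. The amplitude \<alpha> is arbitrary, as the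
      constraint involves only h.\<close>
    then have "(\<Sum>t<L. (conjugate h \<bullet> Y t - \<alpha> * c t - (conjugate h0 \<bullet> Y t - \<alpha>0 * c t)) * ?r t) =
        (\<Sum>t<L. (?u \<bullet> Y t) * ?r t) - (\<alpha> - \<alpha>0) * (\<Sum>t<L. c t * ?r t)"
      by (simp only: sum_distrib_left flip: sum_subtractf) (rule sum.cong; simp add: algebra_simps)
    ultimately show "(\<Sum>t<L. (conjugate h \<bullet> Y t - \<alpha> * c t - (conjugate h0 \<bullet> Y t - \<alpha>0 * c t)) * ?r t) = 0"
      using noise_orth by simp
  qed
  with h0 h0b show ?thesis
    by (auto simp: is_arg_min_def napes_feasible_def not_less simp flip: h0_def \<alpha>0_def b_def)
qed

theorem proposition1:
  fixes M L N :: nat and x y :: "complex vec" and \<omega> :: real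
  assumes "0 < M" and "0 < L" and "N = M + L - 1"
    and "y \<in> carrier_vec N" and "x \<in> carrier_vec N"
    and "\<omega> \<in> {0..<2 * pi}"
    and "vec_first x L \<noteq> 0\<^sub>v L"
    and "invertible_mat (napes_Q M L y x \<omega>)"
    and "napes_denom M L y x \<omega> \<noteq> 0"
  shows "napes_g M L y x \<omega> =
           of_real (1 / sq_norm_cvec (vec_first x L)) \<cdot>\<^sub>v
           (data_mat M L y *\<^sub>v conjugate (modulated_noise L x \<omega>))
    \<and> napes_Q M L y x \<omega> =
           of_real (1 / sq_norm_cvec (vec_first x L)) \<cdot>\<^sub>m
           (data_mat M L y * mat_adjoint (data_mat M L y))
           - outer_prod (napes_g M L y x \<omega>) (napes_g M L y x \<omega>)
    \<and> is_arg_min (napes_objective M L y x \<omega>) (napes_feasible M x \<omega>)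
        (napes_h M L y x \<omega>, napes_alpha M L y x \<omega>)"
  \<comment> \<open>Rewriting the data-matrix expressions back into sums turns the first two
    conjuncts into trivial identities.\<close>
  using is_arg_min_napes[OF assms(7-9)]
  by (simp only: napes_g_eq_data_mat[symmetric] finsum_outer_snapshot_eq_data_mat[symmetric]
      napes_Q_def[symmetric] simp_thms)

end
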